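(* Let $DP=\{(a_i,-b_i)\}_{i=1}^n\subset\mathbb{R}^2$ be the finite set of points dual to the constraints $a_ix+b_i\le t$, $i=1,\dots,n$. Suppose $DP$ is partitioned into two nonempty sets, $L$ (the points with negative first coordinate) and $R$ (the points with positive first coordinate). Run the alternating iteration described in the context from some $p_0\in L$. When it terminates, the last two points $p_k$ and $p_{k+1}$ (one in $L$, the other in $R$) are part of the lower convex hull $\mathcal{LH}(DP)$, and the segment $(p_k,p_{k+1})$ intersects the $y$-axis.
   Context: The problem considered is: minimize $t$ over $(x,t)\in\mathbb{R}^2$ subject to $a_ix+b_i\le t$ for $i=1,\dots,n$. The constraint $a_ix+b_i\le t$ is transformed into the dual point $(a_i,-b_i)$. In the dual plane the coordinates are called $x$ (first) and $y$ (second), and the $y$-axis is the line $\{x=0\}$. $\mathcal{LH}(DP)$ denotes the lower convex hull of $DP$, that is, the set of points $(x,y)$ of the convex hull of $DP$ such that no $(x,y')$ with $y'<y$ belongs to the convex hull of $DP$. The alternating iteration, started at $p_0\in L$, is: repeat until no change, given $p_i$ in $L$ (respectively in $R$), find a point $p_{i+1}$ in $R$ (respectively in $L$) with the largest clockwise (respectively counter-clockwise) turn as seen from $p_i$. Explicitly: - If $p_i\in L$, then $p_{i+1}\in R$ is chosen so that the line through $p_i$ and $p_{i+1}$ has the smallest slope among all lines through $p_i$ and a point of $R$. - If $p_i\in R$, then $p_{i+1}\in L$ is chosen so that the line through $p_i$ and $p_{i+1}$ has the largest slope among all lines through $p_i$ and a point of $L$. Tie convention: for $i\ge 1$, if the previous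 point $p_{i-1}$ is itself among the optimal choices for $p_{i+1}$ (no point gives a strictly larger turn), then $p_{i+1}=p_{i-1}$. Other ties are broken arbitrarily. "No change" means $p_{i+1}=p_{i-1}$ for some $i\ge1$. The iteration then terminates, and the last two points $p_k,p_{k+1}$ are the two points $p_i$ and $p_{i+1}=p_{i-1}$, each of which is an optimal choice as seen from the other. *)

theory Defs
  imports "HOL-Analysis.Analysis"
begin

definition dual_points :: "nat \<Rightarrow> (nat \<Rightarrow> real) \<Rightarrow> (nat \<Rightarrow> real) \<Rightarrow> (real \<times> real) set" where
  "dual_points n a b = (\<lambda>i. (a i, - b i)) ` {1..n}"

definition lower_hull :: "(real \<times> real) set \<Rightarrow> (real \<times> real) set" where
  "lower_hull S = {(x, y). (x, y) \<in> convex hull S \<and> (\<forall>y'<y. (x, y') \<notin> convex hull S)}"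

definition slope :: "real \<times> real \<Rightarrow> real \<times> real \<Rightarrow> real" where
  "slope p q = (snd q - snd p) / (fst q - fst p)"

definition best_choices ::
  "(real \<times> real) set \<Rightarrow> (real \<times> real) set \<Rightarrow> real \<times> real \<Rightarrow> (real \<times> real) set" where
  "best_choices L R p =
     {q. (p \<in> L \<and> q \<in> R \<and> (\<forall>r\<in>R. slope p q \<le> slope p r)) \<or>
         (p \<in> R \<and> q \<in> L \<and> (\<forall>r\<in>L. slope p r \<le> slope p q))}"

text \<open>A run that stops at step \<open>k\<close> consists of the points \<open>p 0, \<dots>, p (k + 1)\<close>;
  the values of \<open>p\<close> beyond \<open>k + 1\<close> play no role. The third conjunct is the tie convention,
  and the last three say that \<open>k\<close> is the first step at which there is no change.\<close>

definition terminated_run ::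
  "(real \<times> real) set \<Rightarrow> (real \<times> real) set \<Rightarrow> (nat \<Rightarrow> real \<times> real) \<Rightarrow> nat \<Rightarrow> bool" where
  "terminated_run L R p k \<longleftrightarrow>
     p 0 \<in> L \<and>
     (\<forall>i\<le>k. p (i + 1) \<in> best_choices L R (p i)) \<and>
     (\<forall>i. 1 \<le> i \<and> i \<le> k \<and> p (i - 1) \<in> best_choices L R (p i) \<longrightarrow> p (i + 1) = p (i - 1)) \<and>
     1 \<le> k \<and>
     p (k + 1) = p (k - 1) \<and>
     (\<forall>i. 1 \<le> i \<and> i < k \<longrightarrow> p (i + 1) \<noteq> p (i - 1))"

end

theory Submission
  imports Defs
begin

text \<open>
  When the iteration stops, its last two points \<open>l\<close> in \<open>L\<close> and \<open>r\<close> in \<open>R\<close> are optimal choices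
  as seen from each other. Optimality of \<open>r\<close> as seen from \<open>l\<close> says that no point of \<open>R\<close> lies
  below the line through \<open>l\<close> and \<open>r\<close>; optimality of \<open>l\<close> as seen from \<open>r\<close> says the same of the
  points of \<open>L\<close>. The slope is minimised over \<open>R\<close> but maximised over \<open>L\<close> because the points of
  \<open>L\<close> are to the left of \<open>r\<close>. So this line supports the convex hull of \<open>L \<union> R\<close> from below, and
  its two points \<open>l\<close> and \<open>r\<close> lie on the lower hull. Their segment meets the vertical axis because
  their first coordinates have opposite signs.
\<close>

text \<open>The closed half-plane above a line is convex, so the line bounds the whole convex hull from
  below as soon as it bounds the points; nothing of the hull can then lie below a point on it.\<close>

lemma supporting_line_point_in_lower_hull:
  assumes above: "\<And>z. z \<in> S \<Longrightarrow> m * fst z + c \<le> snd z"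
    and "q \<in> S" and on_line: "snd q = m * fst q + c"
  shows "q \<in> lower_hull S"
proof -
  let ?H = "{z. inner (- m, 1) z \<ge> c} :: (real \<times> real) set"
  have "S \<subseteq> ?H"
    using above by (auto simp: inner_prod_def algebra_simps)
  then have hull: "convex hull S \<subseteq> ?H"
    by (intro hull_minimal convex_halfspace_ge)
  have "(fst q, y') \<notin> convex hull S" if "y' < snd q" for y'
    using hull that on_line by (auto simp: inner_prod_def)
  moreover have "q \<in> convex hull S"
    using \<open>q \<in> S\<close> by (rule hull_inc)
  ultimately show ?thesis
    by (auto simp: lower_hull_def case_prod_beta)
qed

lemma segment_meets_vertical_axis:
  fixes l r :: "real \<times> real"
  assumes "fst l < 0" "fst r > 0"
  shows "closed_segment l r \<inter> {z. fst z = 0} \<noteq> {}"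
proof -
  \<comment> \<open>the weight for which the first coordinate \<open>(1 - u) * fst l + u * fst r\<close> vanishes\<close>
  define u where "u = - fst l / (fst r - fst l)"
  have "0 \<le> u" "u \<le> 1"
    using assms by (auto simp: u_def field_simps)
  then have "(1 - u) *\<^sub>R l + u *\<^sub>R r \<in> closed_segment l r"
    by (auto simp: in_segment)
  moreover have "u * (fst r - fst l) = - fst l"
    using assms by (simp add: u_def)
  then have "fst ((1 - u) *\<^sub>R l + u *\<^sub>R r) = 0"
    by (simp add: algebra_simps)
  ultimately show ?thesis
    by blast
qed

lemma mutually_best_in_lower_hull:
  assumes neg: "\<And>z. z \<in> L \<Longrightarrow> fst z < 0" and pos: "\<And>z. z \<in> R \<Longrightarrow> fst z > 0"
    and "l \<in> L" "r \<in> R"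
    and r_best: "r \<in> best_choices L R l" and l_best: "l \<in> best_choices L R r"
  shows "l \<in> lower_hull (L \<union> R) \<and> r \<in> lower_hull (L \<union> R)"
proof -
  define m where "m = slope l r"
  define c where "c = snd l - m * fst l"
  have lr: "fst l < 0" "fst r > 0"
    using assms by auto
  have slope_sym: "slope r l = m"
    using lr by (simp add: m_def slope_def divide_simps) (simp add: algebra_simps)
  have "m * (fst r - fst l) = snd r - snd l"
    using lr by (simp add: m_def slope_def)
  then have r_line: "snd r = m * fst r + c"
    by (simp add: c_def algebra_simps)
  \<comment> \<open>the signs of the first coordinates keep \<open>L\<close> and \<open>R\<close> disjoint, which fixes the applicable
    alternative in the definition of the best choices\<close>
  have "l \<notin> R" "r \<notin> L"
    using lr neg [of r] pos [of l] by auto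
  have above: "m * fst z + c \<le> snd z" if "z \<in> L \<union> R" for z
    using that
  proof
    assume "z \<in> L"
    then have "slope r z \<le> m"
      using l_best \<open>r \<notin> L\<close> by (auto simp: best_choices_def slope_sym)
    moreover have "fst z - fst r < 0"
      using neg [OF \<open>z \<in> L\<close>] lr by linarith
    ultimately have "m * (fst z - fst r) \<le> snd z - snd r"
      by (simp add: slope_def neg_divide_le_eq [of "fst z - fst r"])
    then show ?thesis
      using r_line by (simp add: algebra_simps)
  next
    assume "z \<in> R"
    then have "m \<le> slope l z"
      using r_best \<open>l \<notin> R\<close> by (auto simp: best_choices_def m_def)
    moreover have "0 < fst z - fst l"
      using pos [OF \<open>z \<in> R\<close>] lr by linarith
    ultimately have "m * (fst z - fst l) \<le> snd z - snd l"
      by (simp add: slope_def pos_le_divide_eq)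
    then show ?thesis
      by (simp add: c_def algebra_simps)
  qed
  have "l \<in> lower_hull (L \<union> R)"
    by (rule supporting_line_point_in_lower_hull [OF above]) (use \<open>l \<in> L\<close> in \<open>auto simp: c_def\<close>)
  moreover have "r \<in> lower_hull (L \<union> R)"
    by (rule supporting_line_point_in_lower_hull [OF above]) (use \<open>r \<in> R\<close> r_line in auto)
  ultimately show ?thesis
    by blast
qed

theorem mainTheorem2:
  fixes n :: nat and a b :: "nat \<Rightarrow> real"
    and DP L R :: "(real \<times> real) set"
    and p :: "nat \<Rightarrow> real \<times> real" and k :: nat
  assumes "DP = dual_points n a b"
    and "L = {z \<in> DP. fst z < 0}"
    and "R = {z \<in> DP. fst z > 0}"
    and "DP = L \<union> R" and "L \<noteq> {}" and "R \<noteq> {}"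
    and "terminated_run L R p k"
  shows "((p k \<in> L \<and> p (k + 1) \<in> R) \<or> (p k \<in> R \<and> p (k + 1) \<in> L)) \<and>
         p k \<in> lower_hull DP \<and> p (k + 1) \<in> lower_hull DP \<and>
         closed_segment (p k) (p (k + 1)) \<inter> {z. fst z = 0} \<noteq> {}"
proof -
  have neg: "fst z < 0" if "z \<in> L" for z
    using that assms(2) by auto
  have pos: "fst z > 0" if "z \<in> R" for z
    using that assms(3) by auto
  have run: "\<And>i. i \<le> k \<Longrightarrow> p (i + 1) \<in> best_choices L R (p i)"
    and "1 \<le> k" and no_change: "p (k + 1) = p (k - 1)"
    using assms(7) by (auto simp: terminated_run_def)
  have next_best: "p (k + 1) \<in> best_choices L R (p k)"
    using run by blast
  \<comment> \<open>\<open>p k\<close> was chosen from \<open>p (k - 1)\<close>, which is \<open>p (k + 1)\<close>: optimality is mutual\<close>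
  have prev_best: "p k \<in> best_choices L R (p (k + 1))"
    using run [of "k - 1"] \<open>1 \<le> k\<close> no_change by simp
  from next_best consider "p k \<in> L" "p (k + 1) \<in> R" | "p k \<in> R" "p (k + 1) \<in> L"
    by (auto simp: best_choices_def)
  then show ?thesis
  proof cases
    case 1
    with mutually_best_in_lower_hull [OF neg pos 1 next_best prev_best]
      segment_meets_vertical_axis [OF neg pos, OF 1] assms(4)
    show ?thesis
      by simp
  next
    case 2
    with mutually_best_in_lower_hull [OF neg pos 2(2,1) prev_best next_best]
      segment_meets_vertical_axis [OF neg pos, OF 2(2,1)] assms(4)
    show ?thesis
      by (simp add: closed_segment_commute)
  qed
qed

end
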